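(* There exists $\varepsilon_3 > 0$ such that $$c_3 < \frac{1}{2\sqrt{2}} - \varepsilon_3,$$ where $c_3 = \sup\{\lambda_3(G)/n : G \text{ a graph with } |V(G)| = n \ge 3\}$.
   Context: Graphs are finite, simple and undirected. For a graph $G$ on $n \ge 3$ vertices, $\lambda_1(G) \ge \lambda_2(G) \ge \dots \ge \lambda_n(G)$ denote the eigenvalues (with multiplicity) of its adjacency matrix. The supremum is over all orders $n \ge 3$ and all graphs of order $n$. *)

theory Defs
  imports
    "Jordan_Normal_Form.Char_Poly"
    "Graph_Theory.Pair_Digraph"
    Complex_Main
begin

(* A finite simple undirected graph is a "pair_graph" of Graph_Theory: a finite loop-free digraph
   without parallel arcs whose arc relation is symmetric, so that an undirected edge is a pair of
   opposite arcs.  Vertices are natural numbers; every finite graph has an isomorphic copy of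
   this form. *)

abbreviation order_of :: "nat pair_pre_digraph \<Rightarrow> nat" where
  "order_of G \<equiv> card (pverts G)"

(* Rows and columns are indexed by the vertices in increasing order. *)
definition adjacency_matrix :: "nat pair_pre_digraph \<Rightarrow> real mat" where
  "adjacency_matrix G =
     (let vs = sorted_list_of_set (pverts G) in
      mat (order_of G) (order_of G) (\<lambda>(i, j). if (vs ! i, vs ! j) \<in> parcs G then 1 else 0))"

(* The real eigenvalues, repeated according to algebraic multiplicity, in non-increasing order.
   For an adjacency matrix these are all the eigenvalues: see length_eigenvalues_adjacency. *)
definition eigenvalues_desc :: "real mat \<Rightarrow> real list" where
  "eigenvalues_desc A = rev (sorted_list_of_multiset (proots (char_poly A)))"

(* The k-th largest eigenvalue with k counted from 1; meaningful for 1 <= k <= order_of G. *)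
definition graph_eigenvalue :: "nat \<Rightarrow> nat pair_pre_digraph \<Rightarrow> real" where
  "graph_eigenvalue k G = eigenvalues_desc (adjacency_matrix G) ! (k - 1)"

(* The set is nonempty and bounded above (eigenvalue_ratios_nonempty, bdd_above_eigenvalue_ratios
   below), so Sup is the actual supremum. *)
definition eigenvalue_ratios :: "nat \<Rightarrow> real set" where
  "eigenvalue_ratios k =
     {graph_eigenvalue k G / real (order_of G) | G. pair_graph G \<and> order_of G \<ge> k}"

definition c3 :: real where
  "c3 = Sup (eigenvalue_ratios 3)"


lemma adjacency_matrix_carrier: "adjacency_matrix G \<in> carrier_mat (order_of G) (order_of G)"
  by (simp add: adjacency_matrix_def Let_def)

lemma adjacency_matrix_sym:
  assumes "pair_graph G" "i < order_of G" "j < order_of G"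
  shows "adjacency_matrix G $$ (i, j) = adjacency_matrix G $$ (j, i)"
proof -
  interpret pair_graph G by fact
  have "sym (parcs G)"
    using pair_sym_arcs by (simp add: symmetric_def)
  then show ?thesis
    using assms(2,3) by (auto simp: adjacency_matrix_def Let_def dest: symD)
qed

lemma adjacency_matrix_entry:
  assumes "i < order_of G" "j < order_of G"
  shows "\<bar>adjacency_matrix G $$ (i, j)\<bar> \<le> 1"
  using assms by (auto simp: adjacency_matrix_def Let_def)

lemma eigenvalue_symmetric_real:
  fixes A :: "real mat" and a :: complex
  assumes A: "A \<in> carrier_mat n n"
    and sym: "\<And>i j. i < n \<Longrightarrow> j < n \<Longrightarrow> A $$ (i, j) = A $$ (j, i)"
    and ev: "eigenvalue (map_mat complex_of_real A) a"
  shows "a \<in> \<real>"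
proof -
  obtain v where v: "v \<in> carrier_vec n" "v \<noteq> 0\<^sub>v n"
    and eq: "map_mat complex_of_real A *\<^sub>v v = a \<cdot>\<^sub>v v"
    using ev A unfolding eigenvalue_def eigenvector_def by auto
  have row: "(\<Sum>j<n. of_real (A $$ (i, j)) * v $ j) = a * v $ i" if i: "i < n" for i
  proof -
    have "(map_mat complex_of_real A *\<^sub>v v) $ i = (a \<cdot>\<^sub>v v) $ i"
      by (simp add: eq)
    then show ?thesis
      using i A v by (simp add: scalar_prod_def lessThan_atLeast0)
  qed
  define S where "S = (\<Sum>i<n. \<Sum>j<n. cnj (v $ i) * (of_real (A $$ (i, j)) * v $ j))"
  define N where "N = (\<Sum>i<n. (cmod (v $ i))\<^sup>2)"
  have S: "S = a * of_real N"
  proof -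
    have "S = (\<Sum>i<n. cnj (v $ i) * (a * v $ i))"
      unfolding S_def by (simp add: sum_distrib_left[symmetric] row)
    also have "\<dots> = (\<Sum>i<n. a * of_real ((cmod (v $ i))\<^sup>2))"
      by (intro sum.cong refl) (simp only: complex_norm_square mult_ac)
    finally show ?thesis
      by (simp add: N_def sum_distrib_left)
  qed
  have "cnj S = (\<Sum>i<n. \<Sum>j<n. v $ i * (of_real (A $$ (i, j)) * cnj (v $ j)))"
    by (simp add: S_def)
  also have "\<dots> = (\<Sum>j<n. \<Sum>i<n. v $ i * (of_real (A $$ (i, j)) * cnj (v $ j)))"
    by (rule sum.swap)
  also have "\<dots> = S"
    unfolding S_def by (intro sum.cong refl) (simp add: sym mult_ac)
  finally have "cnj S = S" .
  obtain i where "i < n" "v $ i \<noteq> 0"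
    using v by (auto simp: vec_eq_iff)
  then have "N > 0"
    unfolding N_def by (intro sum_pos2[of _ i]) auto
  with \<open>cnj S = S\<close> have "cnj a = a"
    by (simp add: S)
  then show ?thesis
    by (simp add: Reals_cnj_iff)
qed

lemma char_poly_symmetric_splits:
  fixes A :: "real mat"
  assumes A: "A \<in> carrier_mat n n"
    and sym: "\<And>i j. i < n \<Longrightarrow> j < n \<Longrightarrow> A $$ (i, j) = A $$ (j, i)"
  shows "size (proots (char_poly A)) = n"
proof -
  let ?B = "map_mat complex_of_real A"
  have B: "?B \<in> carrier_mat n n"
    using A by simp
  obtain as where as: "char_poly ?B = (\<Prod>a\<leftarrow>as. [:- a, 1:])" "length as = n"
    using char_poly_factorized[OF B] by blast
  have "set as \<subseteq> \<real>"
  proof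
    fix a assume "a \<in> set as"
    then have "poly (char_poly ?B) a = 0"
      unfolding as(1) by (auto simp: poly_prod_list prod_list_zero_iff)
    then show "a \<in> \<real>"
      using eigenvalue_symmetric_real[OF A sym] eigenvalue_root_char_poly[OF B] by blast
  qed
  then have as_eq: "as = map complex_of_real (map Re as)"
    by (induction as) auto
  interpret cr: map_poly_inj_comm_ring_hom complex_of_real ..
  have "map_poly complex_of_real (char_poly A) = char_poly ?B"
    by (rule of_real_hom.char_poly_hom[OF A, symmetric])
  also have "\<dots> = map_poly complex_of_real (\<Prod>r\<leftarrow>map Re as. [:- r, 1:])"
    unfolding as(1) by (subst as_eq) (simp add: cr.hom_prod_list o_def)
  finally have "char_poly A = (\<Prod>r\<leftarrow>map Re as. [:- r, 1:])"
    by (rule cr.injectivity)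
  moreover have "size (proots (\<Prod>r\<leftarrow>rs. [:- r, 1::real:])) = length rs" for rs
  proof (induction rs)
    case (Cons r rs)
    have "(\<Prod>r\<leftarrow>rs. [:- r, 1::real:]) \<noteq> 0"
      by (auto simp: prod_list_zero_iff)
    then show ?case
      using Cons by (simp add: proots_mult del: mult_pCons_left)
  qed simp
  ultimately show ?thesis
    by (metis as(2) length_map)
qed

lemma length_eigenvalues_adjacency:
  assumes "pair_graph G"
  shows "length (eigenvalues_desc (adjacency_matrix G)) = order_of G"
  using char_poly_symmetric_splits[OF adjacency_matrix_carrier adjacency_matrix_sym[OF assms]]
  unfolding eigenvalues_desc_def
  by (metis length_rev mset_sorted_list_of_multiset size_mset)

lemma eigenvalue_le_order:
  assumes "eigenvalue (adjacency_matrix G) x"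
  shows "x \<le> real (order_of G)"
proof -
  let ?A = "adjacency_matrix G" and ?n = "order_of G"
  have A: "?A \<in> carrier_mat ?n ?n"
    by (rule adjacency_matrix_carrier)
  obtain v where v: "v \<in> carrier_vec ?n" "v \<noteq> 0\<^sub>v ?n" and eq: "?A *\<^sub>v v = x \<cdot>\<^sub>v v"
    using assms A unfolding eigenvalue_def eigenvector_def by auto
  obtain k where k: "k < ?n" "v $ k \<noteq> 0"
    using v by (auto simp: vec_eq_iff)
  define m where "m = Max ((\<lambda>j. \<bar>v $ j\<bar>) ` {..<?n})"
  have m: "\<bar>v $ j\<bar> \<le> m" if "j < ?n" for j
    unfolding m_def using that by (intro Max_ge) auto
  have "m \<in> (\<lambda>j. \<bar>v $ j\<bar>) ` {..<?n}"
    unfolding m_def using k by (intro Max_in) auto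
  then obtain i where i: "i < ?n" "m = \<bar>v $ i\<bar>"
    by auto
  have "(?A *\<^sub>v v) $ i = (x \<cdot>\<^sub>v v) $ i"
    by (simp add: eq)
  then have "x * v $ i = (\<Sum>j<?n. ?A $$ (i, j) * v $ j)"
    using i A v by (simp add: scalar_prod_def lessThan_atLeast0)
  then have "\<bar>x\<bar> * m = \<bar>\<Sum>j<?n. ?A $$ (i, j) * v $ j\<bar>"
    by (simp add: i(2) abs_mult[symmetric])
  also have "\<dots> \<le> (\<Sum>j<?n. \<bar>?A $$ (i, j) * v $ j\<bar>)"
    by (rule sum_abs)
  also have "\<dots> \<le> (\<Sum>j<?n. 1 * m)"
    unfolding abs_mult using i m by (intro sum_mono mult_mono adjacency_matrix_entry) auto
  finally have "\<bar>x\<bar> * m \<le> real ?n * m"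
    by simp
  moreover have "m > 0"
    using m[OF k(1)] k(2) by linarith
  ultimately show ?thesis
    by simp
qed

lemma bdd_above_eigenvalue_ratios:
  assumes "k \<ge> 1"
  shows "bdd_above (eigenvalue_ratios k)"
proof (rule bdd_aboveI[of _ 1])
  fix r assume "r \<in> eigenvalue_ratios k"
  then obtain G where G: "pair_graph G" "order_of G \<ge> k"
    and r: "r = graph_eigenvalue k G / real (order_of G)"
    by (auto simp: eigenvalue_ratios_def)
  let ?A = "adjacency_matrix G"
  have "k - 1 < length (eigenvalues_desc ?A)"
    using length_eigenvalues_adjacency[OF G(1)] G(2) assms by simp
  then have "graph_eigenvalue k G \<in> set (eigenvalues_desc ?A)"
    unfolding graph_eigenvalue_def by (rule nth_mem)
  then have "graph_eigenvalue k G \<in># proots (char_poly ?A)"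
    by (simp add: eigenvalues_desc_def)
  moreover have "char_poly ?A \<noteq> 0"
    using degree_monic_char_poly[OF adjacency_matrix_carrier[of G]] by auto
  ultimately have "eigenvalue ?A (graph_eigenvalue k G)"
    by (simp add: eigenvalue_root_char_poly[OF adjacency_matrix_carrier])
  moreover have "real (order_of G) > 0"
    using G(2) assms by linarith
  ultimately show "r \<le> 1"
    using eigenvalue_le_order[of G] by (simp only: r divide_le_eq_1_pos)
qed

lemma eigenvalue_ratios_nonempty: "eigenvalue_ratios k \<noteq> {}"
proof -
  have "pair_graph \<lparr>pverts = {..<k}, parcs = {}\<rparr>"
    by unfold_locales (auto simp: symmetric_def sym_def)
  then show ?thesis
    unfolding eigenvalue_ratios_def by (auto intro!: exI[of _ "\<lparr>pverts = {..<k}, parcs = {}\<rparr>"])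
qed

end

theory Submission
  imports Defs "Jordan_Normal_Form.Schur_Decomposition" "HOL-Analysis.Convex"
begin

text \<open>
  Let \<open>A\<close> be the adjacency matrix of a graph of order \<open>n\<close>, let \<open>J\<close> be the all-ones matrix, and put
  \<open>l = \<lambda>\<^sub>3\<close>. The matrix \<open>B = A - J / 2\<close> has all entries equal to \<open>1 / 2\<close> or \<open>- 1 / 2\<close>, so its squared
  Frobenius norm is \<open>n\<^sup>2 / 4\<close>. The span of three eigenvectors for the largest eigenvalues contains
  orthonormal vectors \<open>p\<close>, \<open>q\<close> orthogonal to the all-ones vector; on them \<open>B\<close> acts like \<open>A\<close>, so both
  Rayleigh quotients are at least \<open>l\<close>. Hence the rank-two matrix \<open>K = l (p p\<^sup>T + q q\<^sup>T)\<close> satisfies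
  \<open>\<parallel>B - K\<parallel>\<^sup>2 \<le> n\<^sup>2 / 4 - 2 l\<^sup>2\<close> (\<open>distance_to_balanced_plane\<close>). Nonnegativity of the left-hand side alone
  gives \<open>l \<le> n / (2 \<surd>2)\<close>.

  The gain comes from the observation that \<open>K\<close> cannot be close to a matrix with entries
  \<open>\<plusminus> 1 / 2\<close>. If it were, the entrywise square of \<open>K\<close> would be close to the constant \<open>1 / 4\<close>. But the
  entrywise square of a Gram matrix of plane vectors is the Gram matrix of their tensor squares; for it
  to be constant these tensor squares would have to coincide, up to sign all the plane vectors would
  then be equal, and \<open>p\<close> and \<open>q\<close> would be proportional, against their orthonormality. The lemma
  \<open>rank_two_square_not_constant\<close> makes this quantitative. The entries of \<open>p\<close> and \<open>q\<close> are
  of order \<open>1 / \<surd>n\<close> because both vectors are images under \<open>A\<close> of short vectors, so passing from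
  \<open>K - B\<close> to the difference of the entrywise squares costs only a constant factor. This bounds
  \<open>n\<^sup>2 / 4 - 2 l\<^sup>2\<close> from below by a fixed multiple of \<open>n\<^sup>2\<close> whenever \<open>l \<ge> n / 3\<close>, and
  \<open>1 / 3\<close> is itself below \<open>1 / (2 \<surd>2)\<close>.

  Orthonormal eigenvectors that belong to the roots of the characteristic polynomial, listed with
  multiplicity, are obtained from a Schur triangularization by orthogonalizing its basis: for a
  symmetric matrix each orthogonalized basis vector is an eigenvector.
\<close>

section \<open>Orthonormal eigenvectors for the list of eigenvalues\<close>

lemma monic_eq_prod_roots:
  fixes p :: "real poly"
  assumes "monic p" "size (proots p) = degree p"
  shows "p = (\<Prod>x\<in>#proots p. [:- x, 1:])"
  using assms
proof (induction "degree p" arbitrary: p)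
  case 0
  then show ?case
    by (metis monic_degree_0 image_mset_empty prod_mset_empty size_eq_0_iff_empty)
next
  case (Suc d)
  have p0: "p \<noteq> 0"
    using Suc.hyps(2) by auto
  obtain x where "x \<in># proots p"
    using Suc by (metis multiset_nonemptyE nat.distinct(1) size_empty)
  then have "poly p x = 0"
    using p0 by simp
  then obtain q where q: "p = [:- x, 1:] * q"
    by (metis poly_eq_0_iff_dvd dvdE)
  have q0: "q \<noteq> 0"
    using p0 q by auto
  have deg: "degree p = Suc (degree q)"
    unfolding q by (subst degree_mult_eq) (use q0 in auto)
  have roots: "proots p = {#x#} + proots q"
    unfolding q by (subst proots_mult) (use q0 in auto)
  have "monic q"
    using Suc.prems(1) unfolding q lead_coeff_mult by simp
  then have "q = (\<Prod>x\<in>#proots q. [:- x, 1:])"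
    using Suc deg roots by auto
  then have "[:- x, 1:] * q = (\<Prod>x\<in>#{#x#} + proots q. [:- x, 1:])"
    by simp
  from trans[OF q this] show ?case
    unfolding roots .
qed

text \<open>
  Gram--Schmidt, one vector at a time. The residue \<open>q\<close> of \<open>p m\<close> is orthogonal to the eigenvectors
  found before, and so is \<open>A q\<close>, because \<open>A\<close> is symmetric; triangularity places \<open>A q - e q\<close> in the
  span of those eigenvectors, so it vanishes. The induction carries two further facts: the matrix
  \<open>T\<close> expresses the \<open>p j\<close> treated so far in the new basis, which turns triangularity into a statement
  about that basis; and the dual vectors \<open>r i\<close> still to come annihilate the new basis, which shows
  \<open>q \<noteq> 0\<close> since \<open>r m\<close> takes the value 1 on it.
\<close>

lemma triangular_imp_orthonormal_eigenvectors:
  fixes a :: "nat \<Rightarrow> nat \<Rightarrow> real" and p r :: "nat \<Rightarrow> nat \<Rightarrow> real"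
  assumes sym: "\<And>x y. x < n \<Longrightarrow> y < n \<Longrightarrow> a x y = a y x"
    and tri: "\<And>k x. k < N \<Longrightarrow> x < n \<Longrightarrow>
      (\<Sum>y<n. a x y * p k y) = e k * p k x + (\<Sum>j<k. b k j * p j x)"
    and dual: "\<And>i j. i < N \<Longrightarrow> j < N \<Longrightarrow> (\<Sum>x<n. r i x * p j x) = (if i = j then 1 else 0)"
    and m: "m \<le> N"
  shows "\<exists>v T. (\<forall>i<m. \<forall>j<m. (\<Sum>x<n. v i x * v j x) = (if i = j then 1 else 0))
      \<and> (\<forall>i<m. \<forall>x<n. (\<Sum>y<n. a x y * v i y) = e i * v i x)
      \<and> (\<forall>j<m. \<forall>x<n. p j x = (\<Sum>i<m. T j i * v i x))
      \<and> (\<forall>j<m. \<forall>i<N. m \<le> i \<longrightarrow> (\<Sum>x<n. r i x * v j x) = 0)"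
    (is "\<exists>v T. ?P m v T")
  using m
proof (induction m)
  case 0
  show ?case by simp
next
  case (Suc m)
  then have "m \<le> N"
    by simp
  from Suc.IH[OF this] obtain v T where P: "?P m v T"
    by blast
  then have on: "(\<Sum>x<n. v i x * v j x) = (if i = j then 1 else 0)" if "i < m" "j < m" for i j
    using that by blast
  have ev: "(\<Sum>y<n. a x y * v i y) = e i * v i x" if "i < m" "x < n" for i x
    using P that by blast
  have sp: "p j x = (\<Sum>i<m. T j i * v i x)" if "j < m" "x < n" for j x
    using P that by blast
  have ann: "(\<Sum>x<n. r i x * v j x) = 0" if "j < m" "i < N" "m \<le> i" for i j
    using P that by blast
  define t where "t i = (\<Sum>x<n. p m x * v i x)" for i
  define q where "q x = p m x - (\<Sum>i<m. t i * v i x)" for x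
  have vsum: "(\<Sum>x<n. v j x * (\<Sum>i<m. f i * v i x)) = f j" if "j < m" for f j
  proof -
    have "(\<Sum>x<n. v j x * (\<Sum>i<m. f i * v i x)) = (\<Sum>i<m. f i * (\<Sum>x<n. v j x * v i x))"
      unfolding sum_distrib_left by (subst sum.swap) (simp add: mult_ac)
    also have "\<dots> = (\<Sum>i<m. if i = j then f j else 0)"
      by (intro sum.cong) (auto simp: on that)
    finally show ?thesis using that by simp
  qed
  have rsum: "(\<Sum>x<n. r k x * (\<Sum>i<m. f i * v i x)) = 0" if "m \<le> k" "k < N" for f k
  proof -
    have "(\<Sum>x<n. r k x * (\<Sum>i<m. f i * v i x)) = (\<Sum>i<m. f i * (\<Sum>x<n. r k x * v i x))"
      unfolding sum_distrib_left by (subst sum.swap) (simp add: mult_ac)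
    then show ?thesis using that by (simp add: ann)
  qed
  have qv: "(\<Sum>x<n. v j x * q x) = 0" if "j < m" for j
    using vsum[OF that, of t] unfolding q_def right_diff_distrib sum_subtractf
    by (simp add: t_def mult.commute)
  have rq: "(\<Sum>x<n. r k x * q x) = (if k = m then 1 else 0)" if "m \<le> k" "k < N" for k
    using rsum[OF that, of t] Suc.prems dual[of k m] that
    unfolding q_def right_diff_distrib sum_subtractf by simp
  define N2 where "N2 = (\<Sum>x<n. q x * q x)"
  have "N2 > 0"
  proof (rule ccontr)
    assume "\<not> N2 > 0"
    moreover have "N2 \<ge> 0" unfolding N2_def by (intro sum_nonneg) auto
    ultimately have "N2 = 0" by simp
    then have "\<And>x. x < n \<Longrightarrow> q x = 0"
      unfolding N2_def by (subst (asm) sum_nonneg_eq_0_iff) auto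
    then show False
      using rq[of m] Suc.prems by simp
  qed
  \<comment> \<open>\<open>Aq - e q\<close> is a combination of the earlier eigenvectors \<dots>\<close>
  define d where "d i = (\<Sum>j<m. b m j * T j i) + e m * t i - t i * e i" for i
  have Aq: "(\<Sum>y<n. a x y * q y) = e m * q x + (\<Sum>i<m. d i * v i x)" if x: "x < n" for x
  proof -
    have 1: "(\<Sum>y<n. a x y * (\<Sum>i<m. t i * v i y)) = (\<Sum>i<m. t i * e i * v i x)"
    proof -
      have "(\<Sum>y<n. a x y * (\<Sum>i<m. t i * v i y)) = (\<Sum>i<m. t i * (\<Sum>y<n. a x y * v i y))"
        unfolding sum_distrib_left by (subst sum.swap) (simp add: mult_ac)
      then show ?thesis using x by (simp add: ev mult_ac)
    qed
    have 2: "(\<Sum>j<m. b m j * p j x) = (\<Sum>i<m. (\<Sum>j<m. b m j * T j i) * v i x)"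
    proof -
      have "(\<Sum>j<m. b m j * p j x) = (\<Sum>j<m. \<Sum>i<m. b m j * T j i * v i x)"
        using x by (simp add: sp sum_distrib_left mult_ac)
      then show ?thesis
        unfolding sum_distrib_right by (subst (asm) sum.swap)
    qed
    have "(\<Sum>y<n. a x y * q y) = (\<Sum>y<n. a x y * p m y) - (\<Sum>y<n. a x y * (\<Sum>i<m. t i * v i y))"
      unfolding q_def right_diff_distrib sum_subtractf ..
    also have "\<dots> = e m * p m x + (\<Sum>i<m. (\<Sum>j<m. b m j * T j i) * v i x)
        - (\<Sum>i<m. t i * e i * v i x)"
      using tri[of m x] Suc.prems x 1 2 by simp
    also have "\<dots> = e m * q x + (\<Sum>i<m. d i * v i x)"
      unfolding q_def d_def right_diff_distrib left_diff_distrib distrib_right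
      by (simp add: sum.distrib sum_subtractf sum_distrib_left mult_ac)
    finally show ?thesis .
  qed
  \<comment> \<open>\<dots> and by symmetry orthogonal to each of them.\<close>
  have d0: "d i = 0" if i: "i < m" for i
  proof -
    have "(\<Sum>x<n. v i x * (\<Sum>y<n. a x y * q y)) = (\<Sum>y<n. (\<Sum>x<n. a y x * v i x) * q y)"
      unfolding sum_distrib_left sum_distrib_right
      by (subst sum.swap) (intro sum.cong refl, auto simp: sym)
    also have "\<dots> = (\<Sum>y<n. e i * (v i y * q y))"
      using i by (simp add: ev mult_ac)
    also have "\<dots> = 0"
      using qv[OF i] by (simp flip: sum_distrib_left)
    finally have "(\<Sum>x<n. v i x * (e m * q x + (\<Sum>i<m. d i * v i x))) = 0"
      by (simp add: Aq)
    moreover have "(\<Sum>x<n. v i x * (e m * q x)) = 0"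
      using qv[OF i] by (simp add: mult.left_commute flip: sum_distrib_left)
    ultimately show ?thesis
      using vsum[OF i, of d] by (simp add: distrib_left sum.distrib)
  qed
  define s where "s = sqrt N2"
  have s: "s \<noteq> 0" "s * s = N2"
    using \<open>N2 > 0\<close> by (auto simp: s_def)
  define v' where "v' i x = (if i = m then q x / s else v i x)" for i x
  define T' where "T' j i = (if j = m then (if i = m then s else t i)
    else (if i = m then 0 else T j i))" for j i
  have v'm: "v' m x = q x / s" and v'i: "i < m \<Longrightarrow> v' i x = v i x" for i x
    by (auto simp: v'_def)
  have on': "(\<Sum>x<n. v' i x * v' j x) = (if i = j then 1 else 0)" if "i < Suc m" "j < Suc m" for i j
  proof -
    have "(\<Sum>x<n. v' m x * v' m x) = 1"
    proof -
      have "(\<Sum>x<n. v' m x * v' m x) = N2 / (s * s)"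
        by (simp add: v'm N2_def sum_divide_distrib)
      then show ?thesis
        using \<open>N2 > 0\<close> by (simp add: s(2))
    qed
    moreover have "(\<Sum>x<n. v' j x * v' m x) = 0" "(\<Sum>x<n. v' m x * v' j x) = 0" if "j < m" for j
      using qv[OF that] that by (simp_all add: v'm v'i mult.commute flip: sum_divide_distrib)
    ultimately show ?thesis
      using that on by (cases "i = m"; cases "j = m") (auto simp: v'i less_Suc_eq)
  qed
  have ev': "(\<Sum>y<n. a x y * v' i y) = e i * v' i x" if "i < Suc m" "x < n" for i x
  proof (cases "i = m")
    case True
    have "(\<Sum>y<n. a x y * (q y / s)) = (\<Sum>y<n. a x y * q y) / s"
      by (simp add: sum_divide_distrib)
    then show ?thesis
      using Aq[OF that(2)] by (simp add: True v'm d0)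
  qed (use that ev in \<open>auto simp: v'i less_Suc_eq\<close>)
  have sp': "p j x = (\<Sum>i<Suc m. T' j i * v' i x)" if "j < Suc m" "x < n" for j x
  proof (cases "j = m")
    case True
    have "p m x = q x + (\<Sum>i<m. t i * v i x)" by (simp add: q_def)
    then show ?thesis
      using s by (simp add: True v'm v'i T'_def)
  qed (use that sp in \<open>auto simp: v'i less_Suc_eq T'_def\<close>)
  have ann': "(\<Sum>x<n. r i x * v' j x) = 0" if "j < Suc m" "i < N" "Suc m \<le> i" for i j
  proof (cases "j = m")
    case True
    then show ?thesis
      using rq[of i] that by (simp add: v'm flip: sum_divide_distrib)
  qed (use that ann in \<open>auto simp: v'i less_Suc_eq\<close>)
  show ?case
    by (intro exI[of _ v'] exI[of _ T'] conjI allI impI) (rule on' ev' sp' ann'; assumption)+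
qed

text \<open>
  The eigenvalue on the diagonal of the Schur form comes in a prescribed order, so the \<open>i\<close>-th
  eigenvector belongs to the \<open>i\<close>-th entry of the list; the rows of the inverse basis change serve as
  dual vectors.
\<close>

lemma symmetric_orthonormal_eigenvectors:
  fixes A :: "real mat"
  assumes A: "A \<in> carrier_mat n n"
    and sym: "\<And>i j. i < n \<Longrightarrow> j < n \<Longrightarrow> A $$ (i, j) = A $$ (j, i)"
  obtains v :: "nat \<Rightarrow> nat \<Rightarrow> real" where
    "\<And>i j. i < n \<Longrightarrow> j < n \<Longrightarrow> (\<Sum>x<n. v i x * v j x) = (if i = j then 1 else 0)"
    "\<And>i x. i < n \<Longrightarrow> x < n \<Longrightarrow> (\<Sum>y<n. A $$ (x, y) * v i y) = eigenvalues_desc A ! i * v i x"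
proof -
  define es where "es = eigenvalues_desc A"
  have ms: "mset es = proots (char_poly A)"
    by (simp add: es_def eigenvalues_desc_def)
  have sz: "size (proots (char_poly A)) = n"
    by (rule char_poly_symmetric_splits[OF A sym])
  have "char_poly A = (\<Prod>x\<in>#proots (char_poly A). [:- x, 1:])"
    using monic_eq_prod_roots degree_monic_char_poly[OF A] sz by metis
  also have "\<dots> = (\<Prod>x\<leftarrow>es. [:- x, 1:])"
    by (simp add: prod_mset_prod_list flip: ms mset_map)
  finally have cp: "char_poly A = (\<Prod>x\<leftarrow>es. [:- x, 1:])" .
  obtain B P Q where dec: "schur_decomposition A es = (B, P, Q)"
    by (cases "schur_decomposition A es") auto
  from schur_decomposition[OF A cp dec]
  have sim: "similar_mat_wit A B P Q" and ut: "upper_triangular B" and diag: "diag_mat B = es"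
    by auto
  note w = similar_mat_witD2[OF A sim]
  have "A * P = P * B * Q * P"
    using w(3) by simp
  also have "\<dots> = P * B * (Q * P)"
    using w by (intro assoc_mult_mat[of _ n n]) auto
  also have "\<dots> = P * B"
    using w by simp
  finally have AP: "A * P = P * B" .
  have Bd: "B $$ (k, k) = es ! k" if "k < n" for k
    using diag that w by (auto simp: diag_mat_def)
  have tri: "(\<Sum>y<n. A $$ (x, y) * P $$ (y, k))
      = es ! k * P $$ (x, k) + (\<Sum>j<k. B $$ (j, k) * P $$ (x, j))" if k: "k < n" and x: "x < n" for k x
  proof -
    have "(A * P) $$ (x, k) = (P * B) $$ (x, k)"
      by (simp add: AP)
    then have "(\<Sum>y<n. A $$ (x, y) * P $$ (y, k)) = (\<Sum>j<n. P $$ (x, j) * B $$ (j, k))"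
      using w k x by (simp add: scalar_prod_def lessThan_atLeast0)
    also have "\<dots> = (\<Sum>j<Suc k. P $$ (x, j) * B $$ (j, k))"
      by (rule sum.mono_neutral_right) (use k ut w(5) in \<open>auto simp: upper_triangular_def\<close>)
    finally show ?thesis
      using Bd[OF k] by (simp add: mult_ac)
  qed
  have dual: "(\<Sum>x<n. Q $$ (i, x) * P $$ (x, j)) = (if i = j then 1 else 0)" if "i < n" "j < n" for i j
  proof -
    have "(Q * P) $$ (i, j) = 1\<^sub>m n $$ (i, j)"
      by (simp add: w)
    then show ?thesis
      using w(4-7) that by (simp add: scalar_prod_def lessThan_atLeast0)
  qed
  have "\<exists>v T. (\<forall>i<n. \<forall>j<n. (\<Sum>x<n. v i x * v j x) = (if i = j then 1 else 0))
      \<and> (\<forall>i<n. \<forall>x<n. (\<Sum>y<n. A $$ (x, y) * v i y) = es ! i * v i x)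
      \<and> (\<forall>j<n. \<forall>x<n. P $$ (x, j) = (\<Sum>i<n. T j i * v i x))
      \<and> (\<forall>j<n. \<forall>i<n. n \<le> i \<longrightarrow> (\<Sum>x<n. Q $$ (i, x) * v j x) = 0)"
    by (rule triangular_imp_orthonormal_eigenvectors[where N = n and b = "\<lambda>k j. B $$ (j, k)"])
      (fact sym tri dual order_refl)+
  then obtain v where
    "\<forall>i<n. \<forall>j<n. (\<Sum>x<n. v i x * v j x) = (if i = j then 1 else 0)"
    "\<forall>i<n. \<forall>x<n. (\<Sum>y<n. A $$ (x, y) * v i y) = es ! i * v i x"
    by (elim exE conjE)
  then show thesis
    by (intro that[of v]) (simp_all only: es_def)
qed

section \<open>A balanced plane of the top eigenspaces\<close>

text \<open>
  The third claim is the delocalization that makes the argument work: a unit vector in the span of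
  eigenvectors with eigenvalues at least \<open>l\<close> has no entry larger than \<open>\<surd>n / l\<close>.
\<close>

lemma eigenvector_combination:
  fixes a v :: "nat \<Rightarrow> nat \<Rightarrow> real" and m n :: nat and l :: real
  assumes on: "\<And>i j. i < m \<Longrightarrow> j < m \<Longrightarrow> (\<Sum>x<n. v i x * v j x) = (if i = j then 1 else 0)"
    and ev: "\<And>i x. i < m \<Longrightarrow> x < n \<Longrightarrow> (\<Sum>y<n. a x y * v i y) = e i * v i x"
    and e: "\<And>i. i < m \<Longrightarrow> l \<le> e i" and l: "l > 0"
    and a: "\<And>x y. x < n \<Longrightarrow> y < n \<Longrightarrow> \<bar>a x y\<bar> \<le> 1"
  defines "w \<equiv> \<lambda>c x. \<Sum>i<m. c i * v i x"
  shows "(\<Sum>x<n. w c x * w d x) = (\<Sum>i<m. c i * d i)"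
    and "l * (\<Sum>i<m. (c i)\<^sup>2) \<le> (\<Sum>x<n. \<Sum>y<n. w c x * a x y * w c y)"
    and "x < n \<Longrightarrow> (w c x)\<^sup>2 \<le> n / l\<^sup>2 * (\<Sum>i<m. (c i)\<^sup>2)"
proof -
  have inner: "(\<Sum>x<n. w c x * w d x) = (\<Sum>i<m. c i * d i)" for c d
  proof -
    have "(\<Sum>x<n. w c x * w d x) = (\<Sum>x<n. \<Sum>i<m. \<Sum>j<m. c i * d j * (v i x * v j x))"
      unfolding w_def sum_product by (simp add: mult_ac)
    also have "\<dots> = (\<Sum>i<m. \<Sum>x<n. \<Sum>j<m. c i * d j * (v i x * v j x))"
      by (rule sum.swap)
    also have "\<dots> = (\<Sum>i<m. \<Sum>j<m. c i * d j * (\<Sum>x<n. v i x * v j x))"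
      unfolding sum_distrib_left by (intro sum.cong refl sum.swap)
    also have "\<dots> = (\<Sum>i<m. \<Sum>j<m. if j = i then c i * d i else 0)"
      by (intro sum.cong refl) (auto simp: on)
    finally show ?thesis by simp
  qed
  have Aw: "(\<Sum>y<n. a x y * w c y) = w (\<lambda>i. e i * c i) x" if "x < n" for c x
  proof -
    have "(\<Sum>y<n. a x y * w c y) = (\<Sum>i<m. c i * (\<Sum>y<n. a x y * v i y))"
      unfolding w_def sum_distrib_left by (subst sum.swap) (simp add: mult_ac)
    then show ?thesis
      using that by (simp add: ev w_def mult_ac)
  qed
  show "(\<Sum>x<n. w c x * w d x) = (\<Sum>i<m. c i * d i)"
    by (rule inner)
  have "(\<Sum>x<n. \<Sum>y<n. w c x * a x y * w c y) = (\<Sum>x<n. w c x * (\<Sum>y<n. a x y * w c y))"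
    by (simp add: sum_distrib_left mult.assoc)
  also have "\<dots> = (\<Sum>i<m. e i * (c i)\<^sup>2)"
    by (simp add: Aw inner power2_eq_square mult_ac)
  also have "\<dots> \<ge> l * (\<Sum>i<m. (c i)\<^sup>2)"
    unfolding sum_distrib_left by (intro sum_mono mult_right_mono) (auto simp: e)
  finally show "l * (\<Sum>i<m. (c i)\<^sup>2) \<le> (\<Sum>x<n. \<Sum>y<n. w c x * a x y * w c y)" .
  assume x: "x < n"
  \<comment> \<open>\<open>w c\<close> is the image of \<open>w d\<close>, a vector of length at most that of \<open>c\<close> divided by \<open>l\<close>.\<close>
  define d where "d i = c i / e i" for i
  have pos: "e i > 0" if "i < m" for i
    using e[OF that] l by simp
  have "w c x = w (\<lambda>i. e i * d i) x"
    unfolding w_def d_def by (intro sum.cong refl) (use pos in force)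
  also have "\<dots> = (\<Sum>y<n. a x y * w d y)"
    by (simp add: Aw x)
  finally have "(w c x)\<^sup>2 \<le> (\<Sum>y<n. (a x y)\<^sup>2) * (\<Sum>y<n. (w d y)\<^sup>2)"
    by (simp add: Cauchy_Schwarz_ineq_sum)
  also have "\<dots> \<le> n * (\<Sum>i<m. (c i)\<^sup>2 / l\<^sup>2)"
  proof (rule mult_mono)
    have "(\<Sum>y<n. (a x y)\<^sup>2) \<le> (\<Sum>y<n. 1)"
      by (intro sum_mono) (use a x in \<open>auto simp: abs_square_le_1\<close>)
    then show "(\<Sum>y<n. (a x y)\<^sup>2) \<le> n"
      by simp
    have "(\<Sum>y<n. (w d y)\<^sup>2) = (\<Sum>i<m. (d i)\<^sup>2)"
      using inner[of d d] by (simp add: power2_eq_square)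
    also have "\<dots> \<le> (\<Sum>i<m. (c i)\<^sup>2 / l\<^sup>2)"
      unfolding d_def power_divide
      by (intro sum_mono divide_left_mono power_mono) (use e l pos in force)+
    finally show "(\<Sum>y<n. (w d y)\<^sup>2) \<le> (\<Sum>i<m. (c i)\<^sup>2 / l\<^sup>2)" .
  qed (auto intro: sum_nonneg)
  finally show "(w c x)\<^sup>2 \<le> n / l\<^sup>2 * (\<Sum>i<m. (c i)\<^sup>2)"
    by (simp flip: sum_divide_distrib)
qed

text \<open>
  Applied to the vector of coordinate sums of three eigenvectors, this yields coefficients for two
  combinations whose own coordinate sums vanish.
\<close>

lemma orthonormal_pair_orthogonal_to:
  fixes s0 s1 s2 :: real
  obtains c0 c1 c2 d0 d1 d2 :: real where
    "c0\<^sup>2 + c1\<^sup>2 + c2\<^sup>2 = 1" "d0\<^sup>2 + d1\<^sup>2 + d2\<^sup>2 = 1" "c0 * d0 + c1 * d1 + c2 * d2 = 0"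
    "c0 * s0 + c1 * s1 + c2 * s2 = 0" "d0 * s0 + d1 * s1 + d2 * s2 = 0"
proof (cases "s0 = 0 \<and> s1 = 0")
  case True
  then show ?thesis
    using that[of 1 0 0 0 1 0] by simp
next
  case False
  \<comment> \<open>\<open>c\<close> is \<open>(s1, - s0, 0)\<close> normalized, and \<open>d\<close> is the normalized cross product of \<open>s\<close> and \<open>c\<close>.\<close>
  define r where "r = sqrt (s0\<^sup>2 + s1\<^sup>2)"
  define R where "R = sqrt (s0\<^sup>2 + s1\<^sup>2 + s2\<^sup>2)"
  have pos: "s0\<^sup>2 + s1\<^sup>2 > 0"
    using False by (simp add: sum_power2_gt_zero_iff)
  have r: "r \<noteq> 0" "r\<^sup>2 = s0\<^sup>2 + s1\<^sup>2"
    using pos by (auto simp: r_def)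
  have "s0\<^sup>2 + s1\<^sup>2 + s2\<^sup>2 > 0"
    using pos by (simp add: add_pos_nonneg)
  then have R: "R \<noteq> 0" "R\<^sup>2 = s0\<^sup>2 + s1\<^sup>2 + s2\<^sup>2"
    by (auto simp: R_def)
  have "(s0 * s2)\<^sup>2 + (s1 * s2)\<^sup>2 + (r\<^sup>2)\<^sup>2 = (r * R)\<^sup>2"
    unfolding power_mult_distrib r R by (simp add: power2_eq_square algebra_simps)
  then have d: "(s0 * s2 / (r * R))\<^sup>2 + (s1 * s2 / (r * R))\<^sup>2 + (- (r\<^sup>2) / (r * R))\<^sup>2 = 1"
    using r(1) R(1) unfolding power_divide power2_minus by (simp flip: add_divide_distrib)
  have c: "(s1 / r)\<^sup>2 + (- s0 / r)\<^sup>2 + 0\<^sup>2 = 1"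
  proof -
    have "(s1 / r)\<^sup>2 + (- s0 / r)\<^sup>2 + 0\<^sup>2 = (s0\<^sup>2 + s1\<^sup>2) / r\<^sup>2"
      by (simp add: power_divide add_divide_distrib)
    then show ?thesis
      using r(1) by (simp flip: r(2))
  qed
  have "s0 * s2 / (r * R) * s0 + s1 * s2 / (r * R) * s1 + - (r\<^sup>2) / (r * R) * s2
      = (s0 * s2 * s0 + s1 * s2 * s1 - r\<^sup>2 * s2) / (r * R)"
    by (simp add: diff_divide_distrib add_divide_distrib)
  also have "\<dots> = 0"
    unfolding r(2) by (simp add: algebra_simps power2_eq_square)
  finally have ds: "s0 * s2 / (r * R) * s0 + s1 * s2 / (r * R) * s1 + - (r\<^sup>2) / (r * R) * s2 = 0" .
  show ?thesis
    by (rule that[OF c d _ _ ds]) simp_all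
qed

lemma balanced_eigenplane:
  fixes a v :: "nat \<Rightarrow> nat \<Rightarrow> real" and l :: real
  assumes on: "\<And>i j. i < 3 \<Longrightarrow> j < 3 \<Longrightarrow> (\<Sum>x<n. v i x * v j x) = (if i = j then 1 else 0)"
    and ev: "\<And>i x. i < 3 \<Longrightarrow> x < n \<Longrightarrow> (\<Sum>y<n. a x y * v i y) = e i * v i x"
    and e: "\<And>i. i < 3 \<Longrightarrow> l \<le> e i" and l: "l > 0"
    and a: "\<And>x y. x < n \<Longrightarrow> y < n \<Longrightarrow> \<bar>a x y\<bar> \<le> 1"
  obtains p q :: "nat \<Rightarrow> real" where
    "(\<Sum>x<n. (p x)\<^sup>2) = 1" "(\<Sum>x<n. (q x)\<^sup>2) = 1" "(\<Sum>x<n. p x * q x) = 0"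
    "(\<Sum>x<n. p x) = 0" "(\<Sum>x<n. q x) = 0"
    "l \<le> (\<Sum>x<n. \<Sum>y<n. p x * a x y * p y)" "l \<le> (\<Sum>x<n. \<Sum>y<n. q x * a x y * q y)"
    "\<forall>x<n. (p x)\<^sup>2 \<le> n / l\<^sup>2" "\<forall>x<n. (q x)\<^sup>2 \<le> n / l\<^sup>2"
proof -
  define s where "s i = (\<Sum>x<n. v i x)" for i
  obtain c0 c1 c2 d0 d1 d2 where cd:
    "c0\<^sup>2 + c1\<^sup>2 + c2\<^sup>2 = 1" "d0\<^sup>2 + d1\<^sup>2 + d2\<^sup>2 = 1" "c0 * d0 + c1 * d1 + c2 * d2 = 0"
    "c0 * s 0 + c1 * s 1 + c2 * s 2 = 0" "d0 * s 0 + d1 * s 1 + d2 * s 2 = 0"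
    by (rule orthonormal_pair_orthogonal_to)
  have three: "(\<Sum>i<3. f i) = f 0 + f 1 + f 2" for f :: "nat \<Rightarrow> real"
    by (simp add: eval_nat_numeral)
  define c where "c = (!) [c0, c1, c2]"
  define d where "d = (!) [d0, d1, d2]"
  have c: "(\<Sum>i<3. (c i)\<^sup>2) = 1" and d: "(\<Sum>i<3. (d i)\<^sup>2) = 1" and "(\<Sum>i<3. c i * d i) = 0"
    and "(\<Sum>i<3. c i * s i) = 0" "(\<Sum>i<3. d i * s i) = 0"
    using cd unfolding three c_def d_def by simp_all
  have total: "(\<Sum>x<n. \<Sum>i<3. f i * v i x) = (\<Sum>i<3. f i * s i)" for f
    unfolding s_def sum_distrib_left by (rule sum.swap)
  note comb = eigenvector_combination[where m = 3 and n = n and v = v and a = a and e = e and l = l, OF on ev e l a]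
  show thesis
  proof (rule that[of "\<lambda>x. \<Sum>i<3. c i * v i x" "\<lambda>x. \<Sum>i<3. d i * v i x"])
    show "(\<Sum>x<n. (\<Sum>i<3. c i * v i x)\<^sup>2) = 1" "(\<Sum>x<n. (\<Sum>i<3. d i * v i x)\<^sup>2) = 1"
      using comb(1)[of c c] comb(1)[of d d] c d by (simp_all add: power2_eq_square)
    show "(\<Sum>x<n. (\<Sum>i<3. c i * v i x) * (\<Sum>i<3. d i * v i x)) = 0"
      using comb(1)[of c d] \<open>(\<Sum>i<3. c i * d i) = 0\<close> by simp
    show "(\<Sum>x<n. \<Sum>i<3. c i * v i x) = 0" "(\<Sum>x<n. \<Sum>i<3. d i * v i x) = 0"
      unfolding total by fact+
    show "l \<le> (\<Sum>x<n. \<Sum>y<n. (\<Sum>i<3. c i * v i x) * a x y * (\<Sum>i<3. c i * v i y))"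
      "l \<le> (\<Sum>x<n. \<Sum>y<n. (\<Sum>i<3. d i * v i x) * a x y * (\<Sum>i<3. d i * v i y))"
      using comb(2)[of c] comb(2)[of d] c d by simp_all
    show "\<forall>x<n. (\<Sum>i<3. c i * v i x)\<^sup>2 \<le> n / l\<^sup>2" "\<forall>x<n. (\<Sum>i<3. d i * v i x)\<^sup>2 \<le> n / l\<^sup>2"
      using comb(3)[of _ c] comb(3)[of _ d] c d by simp_all
  qed
qed

section \<open>Squares of kernels of rank two\<close>

text \<open>
  With \<open>m = 1 / n\<close>, the functions \<open>f = p\<^sup>2 - m\<close>, \<open>g = q\<^sup>2 - m\<close> and \<open>h = p q\<close> have sum zero, and the squared
  kernel is \<open>Z x y = f x f y + g x g y + 2 h x h y\<close> plus terms that depend on at most one of the two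
  variables. These terms are orthogonal to \<open>Z\<close>, so subtracting a constant cannot bring the square sum
  below that of \<open>Z\<close>. The latter is a squared Frobenius norm of the Gram matrix of \<open>f\<close>, \<open>g\<close> and
  \<open>\<surd>2 h\<close>, hence at least a third of the square of its trace, and the trace
  is at least \<open>2 m\<close> by convexity.
\<close>

lemma rank_two_square_not_constant:
  fixes p q :: "nat \<Rightarrow> real" and c :: real
  assumes p: "(\<Sum>x<n. (p x)\<^sup>2) = 1" and q: "(\<Sum>x<n. (q x)\<^sup>2) = 1"
    and pq: "(\<Sum>x<n. p x * q x) = 0"
  shows "4 / (3 * (real n)\<^sup>2) \<le> (\<Sum>x<n. \<Sum>y<n. ((p x * p y + q x * q y)\<^sup>2 - c)\<^sup>2)"
proof -
  have n: "real n > 0"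
    using p by (cases n) auto
  define m where "m = 1 / real n"
  have nm: "real n * m = 1"
    using n by (simp add: m_def)
  define f where "f x = (p x)\<^sup>2 - m" for x
  define g where "g x = (q x)\<^sup>2 - m" for x
  define h where "h x = p x * q x" for x
  have f0: "sum f {..<n} = 0" and g0: "sum g {..<n} = 0" and h0: "sum h {..<n} = 0"
    using p q pq nm by (simp_all add: f_def g_def h_def sum_subtractf)
  define Z where "Z x y = f x * f y + g x * g y + 2 * (h x * h y)" for x y
  \<comment> \<open>The part of the kernel that is constant, and the part that depends on one variable.\<close>
  define k where "k = 2 * m\<^sup>2 - c"
  define u where "u x = m * (f x + g x)" for x
  have expand: "(p x * p y + q x * q y)\<^sup>2 - c = k + u x + u y + Z x y" for x y
    unfolding Z_def k_def u_def f_def g_def h_def by (simp add: power2_eq_square algebra_simps)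
  have lower: "(Z x y)\<^sup>2 + 2 * (k * Z x y + u x * Z x y + u y * Z x y)
      \<le> ((p x * p y + q x * q y)\<^sup>2 - c)\<^sup>2" for x y
  proof -
    have "(k + u x + u y + Z x y)\<^sup>2
      = (Z x y)\<^sup>2 + 2 * (k * Z x y + u x * Z x y + u y * Z x y) + (k + u x + u y)\<^sup>2"
      by (simp add: power2_eq_square algebra_simps)
    then show ?thesis
      unfolding expand by simp
  qed
  have Zy: "(\<Sum>y<n. Z x y) = 0" for x
    using f0 g0 h0 by (simp add: Z_def sum.distrib flip: sum_distrib_left)
  have Zx: "(\<Sum>x<n. Z x y) = 0" for y
    using Zy[of y] by (simp add: Z_def mult.commute)
  have cross: "(\<Sum>x<n. \<Sum>y<n. 2 * (k * Z x y + u x * Z x y + u y * Z x y)) = 0"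
  proof -
    have "(\<Sum>x<n. \<Sum>y<n. u y * Z x y) = (\<Sum>y<n. u y * (\<Sum>x<n. Z x y))"
      unfolding sum_distrib_left by (rule sum.swap)
    then have "(\<Sum>x<n. \<Sum>y<n. u y * Z x y) = 0"
      by (simp add: Zx)
    then show ?thesis
      by (simp add: sum.distrib Zy flip: sum_distrib_left)
  qed
  have prod: "(\<Sum>x<n. \<Sum>y<n. F x * F y) = (sum F {..<n})\<^sup>2" for F :: "nat \<Rightarrow> real"
    by (simp add: power2_eq_square sum_product)
  define ff where "ff = (\<Sum>x<n. (f x)\<^sup>2)"
  define gg where "gg = (\<Sum>x<n. (g x)\<^sup>2)"
  define hh where "hh = (\<Sum>x<n. (h x)\<^sup>2)"
  have "(\<Sum>x<n. \<Sum>y<n. (Z x y)\<^sup>2) = (\<Sum>x<n. \<Sum>y<n.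
      (f x)\<^sup>2 * (f y)\<^sup>2 + (g x)\<^sup>2 * (g y)\<^sup>2 + 4 * ((h x)\<^sup>2 * (h y)\<^sup>2)
      + 2 * ((f x * g x) * (f y * g y)) + 4 * ((f x * h x) * (f y * h y))
      + 4 * ((g x * h x) * (g y * h y)))"
    by (intro sum.cong refl, simp add: Z_def power2_eq_square algebra_simps)
  also have "\<dots> = ff\<^sup>2 + gg\<^sup>2 + 4 * hh\<^sup>2 + 2 * (\<Sum>x<n. f x * g x)\<^sup>2
      + 4 * (\<Sum>x<n. f x * h x)\<^sup>2 + 4 * (\<Sum>x<n. g x * h x)\<^sup>2"
    unfolding ff_def gg_def hh_def prod[symmetric] by (simp add: sum.distrib sum_distrib_left)
  finally have ZZ: "ff\<^sup>2 + gg\<^sup>2 + (2 * hh)\<^sup>2 \<le> (\<Sum>x<n. \<Sum>y<n. (Z x y)\<^sup>2)"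
    by (simp add: power_mult_distrib)
  have "(s + t + u)\<^sup>2 \<le> 3 * (s\<^sup>2 + t\<^sup>2 + u\<^sup>2)" for s t u :: real
  proof -
    have "3 * (s\<^sup>2 + t\<^sup>2 + u\<^sup>2) - (s + t + u)\<^sup>2 = (s - t)\<^sup>2 + (s - u)\<^sup>2 + (t - u)\<^sup>2"
      by (simp add: power2_eq_square algebra_simps)
    then show ?thesis
      by (smt (verit) zero_le_power2)
  qed
  from this[of ff gg "2 * hh"]
  have three: "(ff + gg + 2 * hh)\<^sup>2 / 3 \<le> ff\<^sup>2 + gg\<^sup>2 + (2 * hh)\<^sup>2"
    by simp
  have "2 * m \<le> ff + gg + 2 * hh"
  proof -
    \<comment> \<open>The right-hand side is a convex function of \<open>p\<^sup>2 + q\<^sup>2\<close>, the left-hand side its tangent at the mean \<open>2 m\<close>.\<close>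
    have "2 * m * ((p x)\<^sup>2 + (q x)\<^sup>2) - 2 * m\<^sup>2 \<le> (f x)\<^sup>2 + (g x)\<^sup>2 + 2 * (h x)\<^sup>2" for x
    proof -
      have "(f x)\<^sup>2 + (g x)\<^sup>2 + 2 * (h x)\<^sup>2 - (2 * m * ((p x)\<^sup>2 + (q x)\<^sup>2) - 2 * m\<^sup>2)
        = ((p x)\<^sup>2 + (q x)\<^sup>2 - 2 * m)\<^sup>2"
        unfolding f_def g_def h_def by (simp add: power2_eq_square algebra_simps)
      then show ?thesis
        by (smt (verit) zero_le_power2)
    qed
    then have "(\<Sum>x<n. 2 * m * ((p x)\<^sup>2 + (q x)\<^sup>2) - 2 * m\<^sup>2)
        \<le> (\<Sum>x<n. (f x)\<^sup>2 + (g x)\<^sup>2 + 2 * (h x)\<^sup>2)"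
      by (intro sum_mono)
    also have "(\<Sum>x<n. 2 * m * ((p x)\<^sup>2 + (q x)\<^sup>2) - 2 * m\<^sup>2) = 4 * m - 2 * m * (real n * m)"
      using p q by (simp add: sum_subtractf sum.distrib power2_eq_square flip: sum_distrib_left)
    finally show ?thesis
      by (simp add: nm ff_def gg_def hh_def sum.distrib sum_distrib_left)
  qed
  then have "(2 * m)\<^sup>2 \<le> (ff + gg + 2 * hh)\<^sup>2"
    using n by (intro power_mono) (auto simp: m_def)
  then have "4 / (3 * (real n)\<^sup>2) \<le> (\<Sum>x<n. \<Sum>y<n. (Z x y)\<^sup>2)"
    using three ZZ by (simp add: m_def power_divide)
  also have "\<dots> = (\<Sum>x<n. \<Sum>y<n. (Z x y)\<^sup>2 + 2 * (k * Z x y + u x * Z x y + u y * Z x y))"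
    using cross by (simp only: sum.distrib)
  also have "\<dots> \<le> (\<Sum>x<n. \<Sum>y<n. ((p x * p y + q x * q y)\<^sup>2 - c)\<^sup>2)"
    by (intro sum_mono lower)
  finally show ?thesis .
qed

section \<open>The bound for the third eigenvalue\<close>

text \<open>
  Expanding the square, the cross term between \<open>a\<close> and the plane contributes at most \<open>- 4 l\<^sup>2\<close> and the
  norm of the plane exactly \<open>2 l\<^sup>2\<close>; the constant \<open>1 / 2\<close> is invisible to \<open>p\<close> and \<open>q\<close>.
\<close>

lemma distance_to_balanced_plane:
  fixes a :: "nat \<Rightarrow> nat \<Rightarrow> real" and p q :: "nat \<Rightarrow> real" and l :: real
  assumes a: "\<And>x y. x < n \<Longrightarrow> y < n \<Longrightarrow> a x y = 0 \<or> a x y = 1" and l: "l \<ge> 0"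
    and p: "(\<Sum>x<n. (p x)\<^sup>2) = 1" and q: "(\<Sum>x<n. (q x)\<^sup>2) = 1"
    and pq: "(\<Sum>x<n. p x * q x) = 0" and p0: "(\<Sum>x<n. p x) = 0" and q0: "(\<Sum>x<n. q x) = 0"
    and pa: "l \<le> (\<Sum>x<n. \<Sum>y<n. p x * a x y * p y)"
    and qa: "l \<le> (\<Sum>x<n. \<Sum>y<n. q x * a x y * q y)"
  shows "(\<Sum>x<n. \<Sum>y<n. (l * (p x * p y + q x * q y) - (a x y - 1 / 2))\<^sup>2) \<le> (real n)\<^sup>2 / 4 - 2 * l\<^sup>2"
proof -
  have pointwise: "(l * (p x * p y + q x * q y) - (a x y - 1 / 2))\<^sup>2
      = 1 / 4 - 2 * l * (p x * a x y * p y + q x * a x y * q y) + l * (p x * p y + q x * q y)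
      + l\<^sup>2 * ((p x)\<^sup>2 * (p y)\<^sup>2 + (q x)\<^sup>2 * (q y)\<^sup>2 + 2 * ((p x * q x) * (p y * q y)))"
    if "x < n" "y < n" for x y
    using a[OF that] by (auto simp: power2_eq_square algebra_simps)
  have prod: "(\<Sum>x<n. \<Sum>y<n. F x * F y) = (sum F {..<n})\<^sup>2" for F :: "nat \<Rightarrow> real"
    by (simp add: power2_eq_square sum_product)
  have "(\<Sum>x<n. \<Sum>y<n. (l * (p x * p y + q x * q y) - (a x y - 1 / 2))\<^sup>2)
      = (\<Sum>x<n. \<Sum>y<n. 1 / 4 - 2 * l * (p x * a x y * p y + q x * a x y * q y)
      + l * (p x * p y + q x * q y)
      + l\<^sup>2 * ((p x)\<^sup>2 * (p y)\<^sup>2 + (q x)\<^sup>2 * (q y)\<^sup>2 + 2 * ((p x * q x) * (p y * q y))))"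
    by (intro sum.cong refl pointwise) auto
  also have "\<dots> = (real n)\<^sup>2 / 4
      - 2 * l * ((\<Sum>x<n. \<Sum>y<n. p x * a x y * p y) + (\<Sum>x<n. \<Sum>y<n. q x * a x y * q y)) + 2 * l\<^sup>2"
    unfolding sum.distrib sum_subtractf sum_distrib_left[symmetric] prod p q pq p0 q0
    using p q by (simp add: power2_eq_square)
  also have "\<dots> \<le> (real n)\<^sup>2 / 4 - 2 * l * (l + l) + 2 * l\<^sup>2"
    using pa qa l by (intro add_mono diff_mono mult_left_mono) auto
  finally show ?thesis
    by (simp add: power2_eq_square)
qed

text \<open>
  For \<open>l \<ge> n / 3\<close> the kernel \<open>k\<close> is bounded by 6, so \<open>k\<^sup>2 - b\<^sup>2 = (k + b) (k - b)\<close> with \<open>\<bar>b\<bar> = 1 / 2\<close> is at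
  most \<open>13 / 2\<close> times \<open>k - b\<close>. Comparing the lower bound for the left-hand side with the upper bound
  for the right-hand side gives \<open>4 / 243 \<le> 169 / 4 (1 / 4 - 2 (l / n)\<^sup>2)\<close>, and \<open>1 / 6000\<close> is a round
  number below \<open>8 / (243 \<cdot> 169)\<close>.
\<close>

lemma third_eigenvalue_bound:
  fixes a v :: "nat \<Rightarrow> nat \<Rightarrow> real" and l :: real
  assumes on: "\<And>i j. i < 3 \<Longrightarrow> j < 3 \<Longrightarrow> (\<Sum>x<n. v i x * v j x) = (if i = j then 1 else 0)"
    and ev: "\<And>i x. i < 3 \<Longrightarrow> x < n \<Longrightarrow> (\<Sum>y<n. a x y * v i y) = e i * v i x"
    and e: "\<And>i. i < 3 \<Longrightarrow> l \<le> e i"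
    and a: "\<And>x y. x < n \<Longrightarrow> y < n \<Longrightarrow> a x y = 0 \<or> a x y = 1"
    and n: "n > 0" and l: "l \<ge> n / 3"
  shows "l\<^sup>2 \<le> (1 / 8 - 1 / 6000) * (real n)\<^sup>2"
proof -
  have l0: "l > 0"
    using l n by (smt (verit) divide_pos_pos of_nat_0_less_iff)
  have a1: "\<bar>a x y\<bar> \<le> 1" if "x < n" "y < n" for x y
    using a[OF that] by auto
  obtain p q where pq:
    "(\<Sum>x<n. (p x)\<^sup>2) = 1" "(\<Sum>x<n. (q x)\<^sup>2) = 1" "(\<Sum>x<n. p x * q x) = 0"
    "(\<Sum>x<n. p x) = 0" "(\<Sum>x<n. q x) = 0"
    "l \<le> (\<Sum>x<n. \<Sum>y<n. p x * a x y * p y)" "l \<le> (\<Sum>x<n. \<Sum>y<n. q x * a x y * q y)"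
    and pb: "\<forall>x<n. (p x)\<^sup>2 \<le> n / l\<^sup>2" and qb: "\<forall>x<n. (q x)\<^sup>2 \<le> n / l\<^sup>2"
    by (rule balanced_eigenplane[where n = n and v = v and a = a and e = e and l = l])
      ((rule on ev e l0 a1; assumption) | (rule that; assumption))+
  define k where "k x y = l * (p x * p y + q x * q y)" for x y
  have kb: "\<bar>k x y\<bar> \<le> 6" if "x < n" "y < n" for x y
  proof -
    have amgm: "\<bar>s * t\<bar> \<le> M" if "s\<^sup>2 \<le> M" "t\<^sup>2 \<le> M" for s t M :: real
    proof -
      have "2 * (\<bar>s\<bar> * \<bar>t\<bar>) \<le> s\<^sup>2 + t\<^sup>2"
        using sum_squares_bound[of "\<bar>s\<bar>" "\<bar>t\<bar>"] by (simp add: mult.assoc)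
      then have "\<bar>s\<bar> * \<bar>t\<bar> \<le> M"
        using that by linarith
      then show ?thesis
        by (simp add: abs_mult)
    qed
    have "\<bar>p x * p y\<bar> \<le> n / l\<^sup>2" "\<bar>q x * q y\<bar> \<le> n / l\<^sup>2"
      using pb qb that by (auto intro: amgm)
    then have "\<bar>p x * p y + q x * q y\<bar> \<le> n / l\<^sup>2 + n / l\<^sup>2"
      by (intro order_trans[OF abs_triangle_ineq add_mono])
    then have le: "\<bar>p x * p y + q x * q y\<bar> \<le> 2 * (n / l\<^sup>2)"
      by simp
    have "\<bar>k x y\<bar> = l * \<bar>p x * p y + q x * q y\<bar>"
      using l0 by (simp add: k_def abs_mult)
    also have "\<dots> \<le> l * (2 * (n / l\<^sup>2))"
      using le l0 by (intro mult_left_mono) auto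
    also have "\<dots> = 2 * n / l"
      using l0 by (simp add: power2_eq_square)
    also have "\<dots> \<le> 6"
      using l l0 by (simp add: field_simps)
    finally show ?thesis .
  qed
  \<comment> \<open>Chosen so that \<open>l\<^sup>2 c = b\<^sup>2\<close> for entries \<open>b = \<plusminus> 1 / 2\<close>.\<close>
  define c where "c = 1 / (4 * l\<^sup>2)"
  have term_le: "(l\<^sup>2)\<^sup>2 * ((p x * p y + q x * q y)\<^sup>2 - c)\<^sup>2 \<le> 169 / 4 * (k x y - (a x y - 1 / 2))\<^sup>2"
    if xy: "x < n" "y < n" for x y
  proof -
    define b where "b = a x y - 1 / 2"
    have b: "b\<^sup>2 = 1 / 4" "\<bar>b\<bar> \<le> 1 / 2"
      using a[OF xy] by (auto simp: b_def power2_eq_square)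
    have "l\<^sup>2 * ((p x * p y + q x * q y)\<^sup>2 - c) = (k x y)\<^sup>2 - b\<^sup>2"
      using l0 b by (simp add: k_def c_def power_mult_distrib right_diff_distrib)
    also have "\<dots> = (k x y + b) * (k x y - b)"
      by (simp add: power2_eq_square algebra_simps)
    finally have "(l\<^sup>2)\<^sup>2 * ((p x * p y + q x * q y)\<^sup>2 - c)\<^sup>2 = (k x y + b)\<^sup>2 * (k x y - b)\<^sup>2"
      by (simp only: flip: power_mult_distrib)
    also have "\<dots> \<le> (13 / 2)\<^sup>2 * (k x y - b)\<^sup>2"
    proof (intro mult_right_mono abs_le_square_iff[THEN iffD1])
      show "\<bar>k x y + b\<bar> \<le> \<bar>13 / 2\<bar>"
        using kb[OF xy] b(2) abs_triangle_ineq[of "k x y" b] by simp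
    qed simp
    finally show ?thesis
      by (simp add: b_def power2_eq_square)
  qed
  have "(l\<^sup>2)\<^sup>2 * (4 / (3 * (real n)\<^sup>2))
      \<le> (l\<^sup>2)\<^sup>2 * (\<Sum>x<n. \<Sum>y<n. ((p x * p y + q x * q y)\<^sup>2 - c)\<^sup>2)"
    using pq by (intro mult_left_mono rank_two_square_not_constant) auto
  also have "\<dots> \<le> 169 / 4 * (\<Sum>x<n. \<Sum>y<n. (k x y - (a x y - 1 / 2))\<^sup>2)"
    unfolding sum_distrib_left by (intro sum_mono term_le) auto
  also have "\<dots> \<le> 169 / 4 * ((real n)\<^sup>2 / 4 - 2 * l\<^sup>2)"
    unfolding k_def using l0 pq by (intro mult_left_mono distance_to_balanced_plane a) auto
  finally have main: "(l\<^sup>2)\<^sup>2 * (4 / (3 * (real n)\<^sup>2)) \<le> 169 / 4 * ((real n)\<^sup>2 / 4 - 2 * l\<^sup>2)" .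
  have "(real n / 3)\<^sup>2 \<le> l\<^sup>2"
    using l by (intro power_mono) auto
  then have "((real n / 3)\<^sup>2)\<^sup>2 \<le> (l\<^sup>2)\<^sup>2"
    by (rule power_mono) simp
  then have "((real n / 3)\<^sup>2)\<^sup>2 * (4 / (3 * (real n)\<^sup>2)) \<le> (l\<^sup>2)\<^sup>2 * (4 / (3 * (real n)\<^sup>2))"
    by (intro mult_right_mono) auto
  also have "((real n / 3)\<^sup>2)\<^sup>2 * (4 / (3 * (real n)\<^sup>2)) = 4 / 243 * (real n)\<^sup>2"
    using n by (simp add: power2_eq_square)
  finally have final: "4 / 243 * (real n)\<^sup>2 \<le> 169 / 4 * ((real n)\<^sup>2 / 4 - 2 * l\<^sup>2)"
    using main by linarith
  have "s \<le> (1 / 8 - 1 / 6000) * t" if "4 / 243 * t \<le> 169 / 4 * (t / 4 - 2 * s)" "t \<ge> 0"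
    for s t :: real
    using that by (simp add: algebra_simps)
  from this[OF final zero_le_power2] show ?thesis .
qed

lemma graph_third_eigenvalue_ratio:
  assumes G: "pair_graph G" and n: "order_of G \<ge> 3"
  shows "graph_eigenvalue 3 G / order_of G \<le> sqrt (1 / 8 - 1 / 6000)"
proof -
  define n where "n = order_of G"
  define A where "A = adjacency_matrix G"
  define l where "l = graph_eigenvalue 3 G"
  have n3: "n \<ge> 3"
    using n by (simp add: n_def)
  have A: "A \<in> carrier_mat n n"
    unfolding A_def n_def by (rule adjacency_matrix_carrier)
  obtain v where v:
    "\<And>i j. i < n \<Longrightarrow> j < n \<Longrightarrow> (\<Sum>x<n. v i x * v j x) = (if i = j then 1 else 0)"
    "\<And>i x. i < n \<Longrightarrow> x < n \<Longrightarrow> (\<Sum>y<n. A $$ (x, y) * v i y) = eigenvalues_desc A ! i * v i x"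
    using symmetric_orthonormal_eigenvectors[OF A] adjacency_matrix_sym[OF G]
    unfolding A_def n_def by blast
  have len: "length (eigenvalues_desc A) = n"
    unfolding A_def n_def by (rule length_eigenvalues_adjacency[OF G])
  have "sorted (rev (eigenvalues_desc A))"
    by (simp add: eigenvalues_desc_def)
  then have le: "l \<le> eigenvalues_desc A ! i" if "i < 3" for i
    using sorted_rev_nth_mono[of "eigenvalues_desc A" i 2] that n3 len
    by (simp add: l_def graph_eigenvalue_def A_def)
  have entry: "A $$ (x, y) = 0 \<or> A $$ (x, y) = 1" if "x < n" "y < n" for x y
    using that by (auto simp: A_def n_def adjacency_matrix_def Let_def)
  have "l / n \<le> sqrt (1 / 8 - 1 / 6000)"
  proof (cases "l \<ge> n / 3")
    case True
    have "l\<^sup>2 \<le> (1 / 8 - 1 / 6000) * (real n)\<^sup>2"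
      using third_eigenvalue_bound[where n = n and v = v and l = l
          and a = "\<lambda>x y. A $$ (x, y)" and e = "(!) (eigenvalues_desc A)"]
        v le entry True n3 by simp
    then have "(l / n)\<^sup>2 \<le> 1 / 8 - 1 / 6000"
      using n3 by (simp add: power_divide field_simps)
    then show ?thesis
      by (rule real_le_rsqrt)
  next
    case False
    then have "l / n \<le> 1 / 3"
      using n3 by (simp add: field_simps)
    also have "1 / 3 \<le> sqrt (1 / 8 - 1 / 6000)"
      by (rule real_le_rsqrt) (simp add: power2_eq_square)
    finally show ?thesis .
  qed
  then show ?thesis
    by (simp add: l_def n_def)
qed

theorem theorem1p1:
  shows "\<exists>\<epsilon>::real. \<epsilon> > 0 \<and> c3 < 1 / (2 * sqrt 2) - \<epsilon>"
proof -
  define s where "s = sqrt (1 / 8 - 1 / 6000)"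
  have "x \<le> s" if "x \<in> eigenvalue_ratios 3" for x
    using that graph_third_eigenvalue_ratio unfolding eigenvalue_ratios_def s_def by blast
  then have "c3 \<le> s"
    unfolding c3_def by (rule cSup_least[OF eigenvalue_ratios_nonempty])
  moreover have "s < sqrt (1 / 8)"
    unfolding s_def by simp
  moreover have "sqrt (1 / 8) = 1 / (2 * sqrt 2)"
    by (rule real_sqrt_unique) (simp_all add: power_divide power_mult_distrib)
  ultimately have "c3 < 1 / (2 * sqrt 2)"
    by simp
  then obtain u where "c3 < u" "u < 1 / (2 * sqrt 2)"
    using dense by blast
  then show ?thesis
    by (intro exI[of _ "1 / (2 * sqrt 2) - u"]) simp
qed

end
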